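(* Let $x=P(x)$ be a PPS in simple normal form with LFP $q^*$ satisfying $\mathbf{0} < q^* < \mathbf{1}$. Let $x^{(0)} := \mathbf{0}$ and $x^{(k+1)} := \mathcal{N}_P(x^{(k)})$. Then for every integer $i \geq 1$, $$\| q^* - x^{(32|P| + 2 + 2i)}\|_{\infty} \leq \frac{1}{2^{(28|P|+2)2^i}} \leq \frac{1}{2^{2^{i}}}.$$
   Context: A PPS is a system $x_i = P_i(x)$, $i=1,\dots,n$, with each $P_i$ a polynomial with nonnegative rational coefficients (including constant term) summing to at most $1$; its LFP $q^*$ is the coordinatewise least nonnegative solution. Simple normal form: each $P_i$ is either $x_jx_k$ or linear $\sum_j p_{i,j}x_j+p_{i,0}$. $|P|$ is $n$ plus the total number of bits of all nonzero coefficients (binary numerator/denominator) and nonzero exponents. $B(x)$ is the Jacobian of $P$ and $\mathcal{N}_P(z) := z + (I-B(z))^{-1}(P(z)-z)$. *)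

theory Defs
  imports "HOL-Analysis.Analysis" "HOL-Library.Poly_Mapping" "HOL-Library.Log_Nat"
begin

text \<open>
  A polynomial in the variables \<open>x j\<close>, \<open>j :: 'n\<close>, with rational coefficients is a finitely
  supported map from monomials (finitely supported exponent vectors) to coefficients.
  The number \<open>n\<close> of variables and equations of a system is \<open>CARD('n)\<close>.
\<close>

type_synonym 'n rpoly = "('n \<Rightarrow>\<^sub>0 nat) \<Rightarrow>\<^sub>0 rat"

definition poly_var :: "'n \<Rightarrow> 'n rpoly" where
  "poly_var j = Poly_Mapping.single (Poly_Mapping.single j 1) 1"

definition poly_const :: "rat \<Rightarrow> 'n rpoly" where
  "poly_const c = Poly_Mapping.single 0 c"

definition poly_eval :: "'n::finite rpoly \<Rightarrow> real ^ 'n \<Rightarrow> real" where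
  "poly_eval p x =
    (\<Sum>m\<in>Poly_Mapping.keys p.
       of_rat (Poly_Mapping.lookup p m) * (\<Prod>j\<in>UNIV. (x $ j) ^ Poly_Mapping.lookup m j))"

definition sys_eval :: "('n::finite \<Rightarrow> 'n rpoly) \<Rightarrow> real ^ 'n \<Rightarrow> real ^ 'n" where
  "sys_eval P x = (\<chi> i. poly_eval (P i) x)"

definition is_PPS :: "('n::finite \<Rightarrow> 'n rpoly) \<Rightarrow> bool" where
  "is_PPS P \<longleftrightarrow>
    (\<forall>i. (\<forall>m. 0 \<le> Poly_Mapping.lookup (P i) m) \<and>
         (\<Sum>m\<in>Poly_Mapping.keys (P i). Poly_Mapping.lookup (P i) m) \<le> 1)"

definition simple_normal_form :: "('n::finite \<Rightarrow> 'n rpoly) \<Rightarrow> bool" where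
  "simple_normal_form P \<longleftrightarrow>
    (\<forall>i. (\<exists>j k. P i = poly_var j * poly_var k) \<or>
         (\<exists>p p0. P i = (\<Sum>j\<in>UNIV. poly_const (p j) * poly_var j) + poly_const p0))"

text \<open>The order on \<^typ>\<open>real ^ 'n\<close> is the coordinatewise one.\<close>

definition is_LFP :: "('n::finite \<Rightarrow> 'n rpoly) \<Rightarrow> real ^ 'n \<Rightarrow> bool" where
  "is_LFP P q \<longleftrightarrow>
    0 \<le> q \<and> sys_eval P q = q \<and> (\<forall>y. 0 \<le> y \<and> sys_eval P y = y \<longrightarrow> q \<le> y)"

text \<open>
  Since \<^const>\<open>quotient_of\<close> gives lowest terms, a coefficient is charged the binary lengths of
  its reduced numerator and denominator. A zero coefficient is not a key of the polynomial and
  a zero exponent not a key of the monomial, so neither is charged anything.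
\<close>

definition rat_bits :: "rat \<Rightarrow> nat" where
  "rat_bits r = nat (bitlen (fst (quotient_of r))) + nat (bitlen (snd (quotient_of r)))"

definition sys_size :: "('n::finite \<Rightarrow> 'n rpoly) \<Rightarrow> nat" where
  "sys_size P = CARD('n) +
    (\<Sum>i\<in>UNIV. \<Sum>m\<in>Poly_Mapping.keys (P i).
       rat_bits (Poly_Mapping.lookup (P i) m) +
       (\<Sum>j\<in>Poly_Mapping.keys m. nat (bitlen (int (Poly_Mapping.lookup m j)))))"

definition sys_jacobian :: "('n::finite \<Rightarrow> 'n rpoly) \<Rightarrow> real ^ 'n \<Rightarrow> real ^ 'n ^ 'n" where
  "sys_jacobian P z = jacobian (sys_eval P) (at z)"

text \<open>
  \<^const>\<open>matrix_inv\<close> is total, so the Newton operator at \<open>z\<close> carries its intended meaning only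
  if \<open>mat 1 - sys_jacobian P z\<close> is invertible.
\<close>

definition newton_op :: "('n::finite \<Rightarrow> 'n rpoly) \<Rightarrow> real ^ 'n \<Rightarrow> real ^ 'n" where
  "newton_op P z = z + matrix_inv (mat 1 - sys_jacobian P z) *v (sys_eval P z - z)"

primrec newton_iter :: "('n::finite \<Rightarrow> 'n rpoly) \<Rightarrow> nat \<Rightarrow> real ^ 'n" where
  "newton_iter P 0 = 0"
| "newton_iter P (Suc k) = newton_op P (newton_iter P k)"

end

theory Submission
  imports Defs
begin

text \<open>
  Put \<open>u = 1 - q\<close>. On a row \<open>x j * x k\<close> one has
  \<open>((I - B(x)) u) i = u j * u k + (q - x) j * u k + u j * (q - x) k\<close>, on a linear row it is
  \<open>1 - P i (1) \<ge> 0\<close>, while \<open>(I - B(x)) (q - N(x))\<close> is \<open>(q - x) j * (q - x) k\<close>, respectively \<open>0\<close>.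
  Since \<open>(I - B(x))\<close> has a nonnegative inverse for \<open>0 \<le> x \<le> q\<close>, it follows that \<open>q - x \<le> \<lambda> u\<close>
  implies \<open>q - N(x) \<le> \<lambda>\<^sup>2 / (1 + 2 \<lambda>) u\<close>: the error, measured in units of \<open>u\<close>, is at least
  halved and at least squared. It starts at most at \<open>1 / min u\<close>, and \<open>u \<ge> 2 ^ (- 4 |P|)\<close>.

  For the last bound, a large multiple of \<open>u\<close> satisfies the integer linear inequalities
  \<open>v i \<ge> 1\<close>, \<open>v j + v k - v i \<ge> 1\<close> (product rows) and \<open>\<Sum>j. p i j * v j \<ge> v i\<close> (linear rows with
  \<open>P i (1) = 1\<close>). By Cramer's rule a vertex of this polyhedron has entries at most
  \<open>D = 2 ^ (2 |P|)\<close>, and then \<open>1 - v / D\<^sup>2\<close> is a prefixpoint of \<open>P\<close>, hence above \<open>q\<close>.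
\<close>

section \<open>Small points of integer polyhedra\<close>

lemma integer_det:
  fixes A :: "real ^ 'n ^ 'n"
  assumes "\<And>i j. A $ i $ j \<in> \<int>"
  shows "det A \<in> \<int>"
  unfolding det_def using assms by (intro Ints_sum Ints_mult Ints_prod) auto

text \<open>The Leibniz expansion runs over permutations only, while multiplying out the product of
  row sums gives a nonnegative term for every map from rows to columns.\<close>

lemma abs_det_le_prod_row_sums:
  fixes A :: "real ^ 'n ^ 'n"
  shows "\<bar>det A\<bar> \<le> (\<Prod>i\<in>UNIV. \<Sum>j\<in>UNIV. \<bar>A $ i $ j\<bar>)"
proof -
  have "\<bar>det A\<bar> \<le> (\<Sum>p | p permutes (UNIV :: 'n set).
      \<bar>of_int (sign p) * (\<Prod>i\<in>UNIV. A $ i $ p i)\<bar>)"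
    unfolding det_def by (rule sum_abs)
  also have "\<dots> = (\<Sum>p | p permutes (UNIV :: 'n set). \<Prod>i\<in>UNIV. \<bar>A $ i $ p i\<bar>)"
    by (intro sum.cong refl) (simp add: abs_mult abs_prod sign_def)
  also have "\<dots> \<le> (\<Sum>p\<in>PiE UNIV (\<lambda>_. UNIV). \<Prod>i\<in>UNIV. \<bar>A $ i $ p i\<bar>)"
    by (intro sum_mono2 finite_PiE) (auto simp: prod_nonneg)
  also have "\<dots> = (\<Prod>i\<in>UNIV. \<Sum>j\<in>UNIV. \<bar>A $ i $ j\<bar>)"
    by (rule prod_sum_PiE[symmetric]) auto
  finally show ?thesis .
qed

text \<open>The determinant of an invertible integer matrix has absolute value at least 1, so
  Cramer's rule bounds an entry of \<open>v\<close> by the determinant with one column replaced by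
  the right-hand side. Counting that side in \<open>W\<close> on top of the full row sum makes the
  bound independent of which column is replaced.\<close>

lemma cramer_bound:
  fixes A :: "real ^ 'n ^ 'n" and v :: "real ^ 'n"
  assumes inv: "invertible A"
    and A: "\<And>i j. A $ i $ j \<in> \<int>"
    and W: "\<And>i. (\<Sum>j\<in>UNIV. \<bar>A $ i $ j\<bar>) + \<bar>(A *v v) $ i\<bar> \<le> W i"
  shows "\<bar>v $ k\<bar> \<le> (\<Prod>i\<in>UNIV. W i)"
proof -
  define C where "C = (\<chi> i j. if j = k then (A *v v) $ i else A $ i $ j)"
  have d: "det A \<noteq> 0" "det A \<in> \<int>"
    using inv A by (auto simp: invertible_det_nz intro: integer_det)
  then have "1 \<le> \<bar>det A\<bar>"
    by (rule Ints_nonzero_abs_ge1[rotated])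
  then have "\<bar>v $ k\<bar> \<le> \<bar>v $ k\<bar> * \<bar>det A\<bar>"
    by (simp add: mult_le_cancel_left1)
  also have "\<dots> = \<bar>det C\<bar>"
    unfolding C_def by (subst cramer_lemma) (simp add: abs_mult)
  also have "\<dots> \<le> (\<Prod>i\<in>UNIV. \<Sum>j\<in>UNIV. \<bar>C $ i $ j\<bar>)"
    by (rule abs_det_le_prod_row_sums)
  also have "\<dots> \<le> (\<Prod>i\<in>UNIV. W i)"
  proof (intro prod_mono conjI sum_nonneg)
    fix i
    have "(\<Sum>j\<in>UNIV. \<bar>C $ i $ j\<bar>) \<le> (\<Sum>j\<in>UNIV. \<bar>A $ i $ j\<bar> + (if j = k then \<bar>(A *v v) $ i\<bar> else 0))"
      by (intro sum_mono) (auto simp: C_def)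
    also have "\<dots> = (\<Sum>j\<in>UNIV. \<bar>A $ i $ j\<bar>) + \<bar>(A *v v) $ i\<bar>"
      by (simp add: sum.distrib)
    finally show "(\<Sum>j\<in>UNIV. \<bar>C $ i $ j\<bar>) \<le> W i"
      using W[of i] by linarith
  qed auto
  finally show ?thesis .
qed

text \<open>Since the polyhedron lies in the nonnegative orthant, a sublevel set of the coordinate
  sum \<open>s\<close> is compact, so \<open>s\<close> attains its minimum. The minimal face
  \<open>F\<close> is compact and convex, hence has an extreme point; if the tight constraints there
  did not span, one could move both ways along an orthogonal direction.\<close>

lemma polyhedron_has_vertex:
  fixes a :: "'k \<Rightarrow> real ^ 'n" and b :: "'k \<Rightarrow> real"
  assumes K: "finite K"
    and feasible: "\<And>k. k \<in> K \<Longrightarrow> b k \<le> a k \<bullet> v0"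
    and nonneg: "\<And>v. (\<And>k. k \<in> K \<Longrightarrow> b k \<le> a k \<bullet> v) \<Longrightarrow> 0 \<le> v"
  obtains v where "\<And>k. k \<in> K \<Longrightarrow> b k \<le> a k \<bullet> v"
    and "span (a ` {k \<in> K. a k \<bullet> v = b k}) = UNIV"
proof -
  define S where "S = (\<Inter>k\<in>K. {v. b k \<le> a k \<bullet> v})"
  define s where "s v = (1 :: real ^ 'n) \<bullet> v" for v
  have s: "s v = (\<Sum>i\<in>UNIV. v $ i)" for v
    by (simp add: s_def inner_vec_def)
  have SD: "v \<in> S \<longleftrightarrow> (\<forall>k\<in>K. b k \<le> a k \<bullet> v)" for v
    by (auto simp: S_def)
  have S0: "0 \<le> v" if "v \<in> S" for v
    using that nonneg by (auto simp: SD)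
  have clS: "closed S" "convex S"
    unfolding S_def by (auto intro!: closed_INT convex_INT closed_halfspace_ge convex_halfspace_ge
        simp: Collect_conv_if)
  have v0: "v0 \<in> S" using feasible by (auto simp: SD)
  define S' where "S' = S \<inter> {v. s v \<le> s v0}"
  have "S' \<subseteq> {0..\<chi> i. s v0}"
  proof
    fix v assume v: "v \<in> S'"
    then have "0 \<le> v" by (auto simp: S'_def S0)
    moreover have "v $ i \<le> s v0" for i
    proof -
      have "v $ i \<le> s v"
        unfolding s using \<open>0 \<le> v\<close> by (intro member_le_sum) (auto simp: less_eq_vec_def)
      then show ?thesis using v by (auto simp: S'_def)
    qed
    ultimately show "v \<in> {0..\<chi> i. s v0}" by (auto simp: less_eq_vec_def)
  qed
  moreover have "closed S'"
    unfolding S'_def s_def by (intro closed_Int clS closed_halfspace_le)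
  ultimately have comp: "compact S'"
    using bounded_subset[OF bounded_closed_interval] by (auto simp: compact_eq_bounded_closed)
  have "v0 \<in> S'" using v0 by (auto simp: S'_def)
  have "continuous_on S' s" unfolding s_def by (intro continuous_intros)
  with \<open>v0 \<in> S'\<close> obtain w where w: "w \<in> S'" "\<And>v. v \<in> S' \<Longrightarrow> s w \<le> s v"
    using continuous_attains_inf[OF comp, of s] by auto
  have minw: "s w \<le> s v" if "v \<in> S" for v
    using w that by (cases "s v \<le> s v0") (auto simp: S'_def)
  define F where "F = S' \<inter> {v. s v = s w}"
  have "compact F"
    unfolding F_def s_def by (intro compact_Int_closed comp closed_hyperplane)
  moreover have "convex F"
    unfolding F_def S'_def s_def
    by (intro clS convex_Int convex_hyperplane convex_halfspace_le)
  moreover have "F \<noteq> {}" using w by (auto simp: F_def)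
  ultimately obtain v where v: "v extreme_point_of F"
    using extreme_point_exists_convex by blast
  then have vF: "v \<in> F" by (simp add: extreme_point_of_def)
  then have vS: "v \<in> S" and sv: "s v = s w" by (auto simp: F_def S'_def)
  have FI: "x \<in> F" if "x \<in> S" "s x = s w" for x
    using that w by (auto simp: F_def S'_def)
  have "span (a ` {k \<in> K. a k \<bullet> v = b k}) = UNIV"
  proof (rule ccontr)
    assume "span (a ` {k \<in> K. a k \<bullet> v = b k}) \<noteq> UNIV"
    from span_not_UNIV_orthogonal[OF this] obtain z where z: "z \<noteq> 0"
      and z_orth: "\<forall>x\<in>span (a ` {k \<in> K. a k \<bullet> v = b k}). z \<bullet> x = 0"
      by blast
    have orth: "a k \<bullet> z = 0" if "k \<in> K" "a k \<bullet> v = b k" for k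
      using that z_orth by (subst inner_commute) (blast intro: span_base)
    \<comment> \<open>Constraints tight at \<open>v\<close> do not change along \<open>z\<close>,
      and slack ones survive a small move; finiteness of \<open>K\<close> gives one range of
      \<open>e\<close> for all of them. The factor \<open>c\<close> is later taken as 1 and
      -1.\<close>
    have ev: "\<forall>\<^sub>F e in at_right 0. v + (e * c) *\<^sub>R z \<in> S" for c :: real
    proof -
      have "\<forall>\<^sub>F e in at_right 0. b k \<le> a k \<bullet> (v + (e * c) *\<^sub>R z)" if k: "k \<in> K" for k
      proof (cases "a k \<bullet> v = b k")
        case True
        then show ?thesis using orth[OF k] by (simp add: inner_add_right)
      next
        case False
        then have lt: "b k < a k \<bullet> v" using vS k by (force simp: SD)
        have "((\<lambda>e. a k \<bullet> (v + (e * c) *\<^sub>R z)) \<longlongrightarrow> a k \<bullet> (v + (0 * c) *\<^sub>R z)) (at_right 0)"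
          by (intro tendsto_intros)
        then have "\<forall>\<^sub>F e in at_right 0. b k < a k \<bullet> (v + (e * c) *\<^sub>R z)"
          using lt by (intro order_tendstoD) auto
        then show ?thesis by eventually_elim auto
      qed
      then show ?thesis using K by (auto simp: SD eventually_ball_finite)
    qed
    have "\<forall>\<^sub>F e in at_right (0::real). e > 0 \<and> v + (e * 1) *\<^sub>R z \<in> S \<and> v + (e * -1) *\<^sub>R z \<in> S"
      using ev[of 1] ev[of "-1"] eventually_at_right_less[of 0] by eventually_elim auto
    then obtain e :: real
      where "e > 0 \<and> v + (e * 1) *\<^sub>R z \<in> S \<and> v + (e * -1) *\<^sub>R z \<in> S"
      using eventually_happens'[OF trivial_limit_at_right_real] by blast
    then have e: "e > 0" "v + e *\<^sub>R z \<in> S" "v - e *\<^sub>R z \<in> S"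
      by simp_all
    have "s (v + e *\<^sub>R z) = s v + e * s z" "s (v - e *\<^sub>R z) = s v - e * s z"
      by (auto simp: s_def inner_add_right inner_diff_right)
    \<comment> \<open>As \<open>v\<close> minimises \<open>s\<close>, neither direction can decrease
      it, so both end points remain in the minimal face.\<close>
    moreover from this have "e * s z = 0"
      using minw[OF e(2)] minw[OF e(3)] sv by linarith
    ultimately have "v + e *\<^sub>R z \<in> F" "v - e *\<^sub>R z \<in> F"
      using e sv by (simp_all add: FI)
    moreover have "v \<in> open_segment (v + e *\<^sub>R z) (v - e *\<^sub>R z)"
    proof -
      have "(v + e *\<^sub>R z) - (v - e *\<^sub>R z) = (2 * e) *\<^sub>R z"
        by (simp add: scaleR_2[of "e *\<^sub>R z"] flip: scaleR_scaleR)
      with z e have "v + e *\<^sub>R z \<noteq> v - e *\<^sub>R z" by auto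
      moreover have "midpoint (v + e *\<^sub>R z) (v - e *\<^sub>R z) = v"
        by (simp add: midpoint_def flip: scaleR_2)
      ultimately show ?thesis
        using midpoint_in_open_segment[of "v + e *\<^sub>R z" "v - e *\<^sub>R z"] by simp
    qed
    ultimately show False using v unfolding extreme_point_of_def by blast
  qed
  with vS show thesis by (intro that) (auto simp: SD)
qed

text \<open>A vertex solves a square integer system made of linearly independent tight constraints,
  so Cramer's rule bounds it. It is unknown which constraints are tight; as every \<open>W k\<close>
  is at least 1, the product over the chosen ones is bounded by the product over all of
  \<open>K\<close>.\<close>

lemma integer_polyhedron_small_point:
  fixes a :: "'k \<Rightarrow> real ^ 'n" and b W :: "'k \<Rightarrow> real"
  assumes K: "finite K"
    and feasible: "\<And>k. k \<in> K \<Longrightarrow> b k \<le> a k \<bullet> v0"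
    and nonneg: "\<And>v. (\<And>k. k \<in> K \<Longrightarrow> b k \<le> a k \<bullet> v) \<Longrightarrow> 0 \<le> v"
    and int: "\<And>k i. k \<in> K \<Longrightarrow> a k $ i \<in> \<int>"
    and W: "\<And>k. k \<in> K \<Longrightarrow> (\<Sum>i\<in>UNIV. \<bar>a k $ i\<bar>) + \<bar>b k\<bar> \<le> W k"
    and W1: "\<And>k. k \<in> K \<Longrightarrow> 1 \<le> W k"
  obtains v where "\<And>k. k \<in> K \<Longrightarrow> b k \<le> a k \<bullet> v" and "\<And>i. \<bar>v $ i\<bar> \<le> (\<Prod>k\<in>K. W k)"
proof -
  obtain v where v: "\<And>k. k \<in> K \<Longrightarrow> b k \<le> a k \<bullet> v"
    and sp: "span (a ` {k \<in> K. a k \<bullet> v = b k}) = UNIV"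
    using that polyhedron_has_vertex[where a = a and b = b and K = K and ?v0.0 = v0, OF K feasible nonneg]
    by blast
  define T where "T = {k \<in> K. a k \<bullet> v = b k}"
  obtain B where B: "B \<subseteq> a ` T" "independent B" "a ` T \<subseteq> span B" "card B = dim (a ` T)"
    using basis_exists by blast
  have "span (a ` T) \<subseteq> span B"
    using B(3) by (simp add: span_minimal)
  then have "span B = UNIV"
    using sp by (auto simp: T_def)
  have "card B = CARD('n)"
    using B(4) sp dim_span[of "a ` T"] by (simp add: T_def)
  moreover have "finite B" using B(2) by (rule independent_imp_finite)
  ultimately obtain f :: "'n \<Rightarrow> real ^ 'n" where f: "bij_betw f UNIV B"
    using bij_betw_iff_card[of "UNIV :: 'n set" B] by auto
  have "\<forall>i. \<exists>k. k \<in> T \<and> a k = f i"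
  proof
    fix i
    have "f i \<in> a ` T" using f B(1) by (auto simp: bij_betw_def)
    then show "\<exists>k. k \<in> T \<and> a k = f i" by auto
  qed
  from choice[OF this] obtain g where g: "\<And>i. g i \<in> T" "\<And>i. a (g i) = f i" by blast
  have injg: "inj g"
  proof (rule injI)
    fix i j assume "g i = g j"
    then have "f i = f j" by (simp flip: g(2))
    then show "i = j" using f by (auto simp: bij_betw_def dest: injD)
  qed
  have gK: "g i \<in> K" "a (g i) \<bullet> v = b (g i)" for i
    using g(1)[of i] by (auto simp: T_def)
  define A where "A = (\<chi> i. a (g i))"
  have rows: "rows A = B"
  proof -
    have "row i A = f i" for i
      by (simp add: row_def A_def g(2) vec_lambda_eta)
    then show ?thesis
      using f by (auto simp: rows_def bij_betw_def)
  qed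
  have "invertible A"
    using \<open>span B = UNIV\<close>
    by (simp add: invertible_left_inverse matrix_left_invertible_span_rows rows)
  moreover have Av: "(A *v v) $ i = b (g i)" for i
    by (simp add: matrix_vector_mul_component A_def gK)
  ultimately have bd: "\<bar>v $ i\<bar> \<le> (\<Prod>i\<in>UNIV. W (g i))" for i
    using int[OF gK(1)] W[OF gK(1)] by (intro cramer_bound[of A]) (auto simp: A_def)
  have "(\<Prod>i\<in>UNIV. W (g i)) = (\<Prod>k\<in>range g. W k)"
    using injg by (simp add: prod.reindex)
  also have "\<dots> \<le> (\<Prod>k\<in>K. W k)"
    using gK(1) W1 K by (intro prod_mono2) (auto intro: order_trans[OF zero_le_one])
  finally show thesis using v bd by (intro that) (auto intro: order_trans)
qed

section \<open>Systems of product rows and linear rows\<close>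

text \<open>The analytic content of a PPS in simple normal form, detached from the representation of
  polynomials; it is later instantiated with \<open>sys_eval P\<close>.\<close>

locale quadratic_linear_system =
  fixes quad :: "'n::finite set" and l r :: "'n \<Rightarrow> 'n"
    and p :: "'n \<Rightarrow> 'n \<Rightarrow> real" and c :: "'n \<Rightarrow> real"
    and F :: "real ^ 'n \<Rightarrow> real ^ 'n"
  assumes F_quad: "i \<in> quad \<Longrightarrow> F x $ i = x $ l i * x $ r i"
    and F_lin: "i \<notin> quad \<Longrightarrow> F x $ i = (\<Sum>j\<in>UNIV. p i j * x $ j) + c i"
    and p_nonneg: "i \<notin> quad \<Longrightarrow> 0 \<le> p i j"
    and c_nonneg: "i \<notin> quad \<Longrightarrow> 0 \<le> c i"
    and sum_le_1: "i \<notin> quad \<Longrightarrow> (\<Sum>j\<in>UNIV. p i j) + c i \<le> 1"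
begin

text \<open>The action of the Jacobian \<open>B(x)\<close> on a vector \<open>h\<close>;
  \<open>jacobian_F\<close> provides the link to the matrix.\<close>

definition DF :: "real ^ 'n \<Rightarrow> real ^ 'n \<Rightarrow> real ^ 'n" where
  "DF x h = (\<chi> i. if i \<in> quad then x $ l i * h $ r i + h $ l i * x $ r i
     else (\<Sum>j\<in>UNIV. p i j * h $ j))"

lemma DF_quad: "i \<in> quad \<Longrightarrow> DF x h $ i = x $ l i * h $ r i + h $ l i * x $ r i"
  and DF_lin: "i \<notin> quad \<Longrightarrow> DF x h $ i = (\<Sum>j\<in>UNIV. p i j * h $ j)"
  by (simp_all add: DF_def)

text \<open>Rows have degree at most two, so the Taylor expansion is exact and its remainder is a
  product of two increments.\<close>

lemma F_taylor:
  "F (x + h) $ i = F x $ i + DF x h $ i + (if i \<in> quad then h $ l i * h $ r i else 0)"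
  by (cases "i \<in> quad")
    (simp_all add: F_quad F_lin DF_quad DF_lin algebra_simps sum.distrib)

lemma has_derivative_F: "(F has_derivative DF x) (at x)"
proof -
  have "((\<lambda>y. F y $ i) has_derivative (\<lambda>h. DF x h $ i)) (at x)" for i
  proof (cases "i \<in> quad")
    case True
    then show ?thesis
      by (simp add: F_quad DF_quad)
        (auto intro!: derivative_eq_intros bounded_linear_imp_has_derivative bounded_linear_vec_nth)
  next
    case False
    then show ?thesis
      by (simp add: F_lin DF_lin)
        (auto intro!: derivative_eq_intros bounded_linear_imp_has_derivative bounded_linear_vec_nth)
  qed
  then show ?thesis
    by (subst has_derivative_componentwise_within)
      (auto simp: Basis_vec_def inner_axis)
qed

lemma linear_DF: "linear (DF x)"
  using has_derivative_F by (rule has_derivative_linear)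

lemma jacobian_F: "jacobian F (at x) *v h = DF x h"
  unfolding jacobian_def
  by (simp add: frechet_derivative_at[OF has_derivative_F, symmetric] linear_DF matrix_works)

lemma F_mono:
  assumes "0 \<le> x" "x \<le> y"
  shows "F x \<le> F y"
  unfolding less_eq_vec_def
proof
  fix i
  have "0 \<le> x $ j" "x $ j \<le> y $ j" for j
    using assms by (auto simp: less_eq_vec_def)
  moreover from this have "0 \<le> y $ j" for j by (meson order_trans)
  ultimately show "F x $ i \<le> F y $ i"
    by (cases "i \<in> quad")
      (auto simp: F_quad F_lin p_nonneg intro!: mult_mono sum_mono mult_left_mono)
qed

lemma F_nonneg: "0 \<le> x \<Longrightarrow> 0 \<le> F x"
  unfolding less_eq_vec_def
  apply (rule allI)
  subgoal for i
    by (cases "i \<in> quad") (auto simp: F_quad F_lin p_nonneg c_nonneg intro!: add_nonneg_nonneg sum_nonneg)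
  done

text \<open>Knaster--Tarski on the nonnegative orthant.\<close>

lemma fixpoint_below_prefixpoint:
  assumes y: "0 \<le> y" "F y \<le> y"
  obtains z where "0 \<le> z" "z \<le> y" "F z = z"
proof -
  define A where "A = {x. 0 \<le> x \<and> F x \<le> x}"
  define z where "z = (\<chi> i. INF x\<in>A. x $ i)"
  have bdd: "bdd_below ((\<lambda>x. x $ i) ` A)" for i
    by (rule bdd_belowI[of _ 0]) (auto simp: A_def less_eq_vec_def)
  have yA: "y \<in> A" using y by (simp add: A_def)
  have zle: "z \<le> x" if "x \<in> A" for x
    using that bdd by (auto simp: z_def less_eq_vec_def intro: cINF_lower)
  have zge: "w \<le> z" if "\<And>x. x \<in> A \<Longrightarrow> w \<le> x" for w
    using that yA unfolding z_def less_eq_vec_def by (auto intro!: cINF_greatest)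
  have z0: "0 \<le> z" by (rule zge) (auto simp: A_def)
  have "F z \<le> z"
  proof (rule zge)
    fix x assume x: "x \<in> A"
    then have "F z \<le> F x" using z0 zle by (intro F_mono)
    with x show "F z \<le> x" by (auto simp: A_def)
  qed
  then have "F z \<in> A"
    using z0 by (auto simp: A_def F_nonneg intro: F_mono)
  then have "z \<le> F z" by (rule zle)
  with \<open>F z \<le> z\<close> z0 zle[OF yA] show thesis by (intro that) auto
qed

end

section \<open>The least fixpoint and the nonnegative inverse of \<open>I - B(x)\<close>\<close>

locale quadratic_linear_lfp = quadratic_linear_system quad l r p c F
  for quad :: "'n::finite set" and l r p c F +
  fixes q :: "real ^ 'n"
  assumes q_fix: "F q = q"
    and q_least: "0 \<le> y \<Longrightarrow> F y = y \<Longrightarrow> q \<le> y"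
    and q_pos: "0 < q $ i" and q_less_1: "q $ i < 1"
begin

text \<open>Leastness is assumed among fixpoints only; since every nonnegative prefixpoint has a
  fixpoint below it, any explicit prefixpoint becomes an upper bound for \<open>q\<close>.\<close>

lemma q_le_prefixpoint:
  assumes "0 \<le> y" "F y \<le> y"
  shows "q \<le> y"
  using fixpoint_below_prefixpoint[OF assms] q_least by (metis order_trans)

abbreviation u :: "real ^ 'n" where "u \<equiv> 1 - q"

lemma u_pos: "0 < u $ i" and u_le_1: "u $ i \<le> 1"
  using q_less_1[of i] q_pos[of i] by simp_all

lemma defect_quad:
  assumes "i \<in> quad"
  shows "u $ i - DF x u $ i = u $ l i * u $ r i + (q - x) $ l i * u $ r i + u $ l i * (q - x) $ r i"
proof -
  have "q $ i = q $ l i * q $ r i" using F_quad[OF assms, of q] q_fix by simp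
  then show ?thesis using assms by (simp add: DF_quad algebra_simps)
qed

lemma defect_lin:
  assumes "i \<notin> quad"
  shows "u $ i - DF x u $ i = 1 - ((\<Sum>j\<in>UNIV. p i j) + c i)"
proof -
  have "q $ i = (\<Sum>j\<in>UNIV. p i j * q $ j) + c i" using F_lin[OF assms, of q] q_fix by simp
  then show ?thesis using assms by (simp add: DF_lin algebra_simps sum_subtractf)
qed

text \<open>On such a set \<open>S\<close> the equations form a stochastic linear system in the
  variables of \<open>S\<close> alone, solved by \<open>q\<close> and by the all-ones vector. Moving
  \<open>q\<close> on \<open>S\<close> away from 1, along \<open>- u\<close>, therefore keeps a
  prefixpoint, which contradicts leastness.\<close>

lemma stochastic_closed_empty:
  assumes lin: "\<And>i. i \<in> S \<Longrightarrow> i \<notin> quad \<and> (\<Sum>j\<in>UNIV. p i j) + c i = 1"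
    and closed: "\<And>i j. i \<in> S \<Longrightarrow> 0 < p i j \<Longrightarrow> j \<in> S"
  shows "S = {}"
proof (rule ccontr)
  assume "S \<noteq> {}"
  then obtain k where k: "k \<in> S" by blast
  \<comment> \<open>A step of length \<open>s\<close> keeps \<open>y\<close> nonnegative, because
    \<open>u\<close> is at most 1 and \<open>s\<close> is at most every entry of
    \<open>q\<close>.\<close>
  define s where "s = Min (range (\<lambda>i. q $ i))"
  have s: "0 < s" "\<And>i. s \<le> q $ i"
    unfolding s_def using q_pos by (simp_all add: Min_gr_iff)
  define y where "y = (\<chi> i. if i \<in> S then q $ i - s * u $ i else q $ i)"
  have su: "0 < s * u $ i" "s * u $ i \<le> q $ i" for i
  proof -
    show "0 < s * u $ i" using s(1) u_pos by (rule mult_pos_pos)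
    have "s * u $ i \<le> s * 1" using s(1) u_le_1[of i] by (intro mult_left_mono) auto
    then show "s * u $ i \<le> q $ i" using s(2)[of i] by linarith
  qed
  have y: "0 \<le> y" "y \<le> q"
    using su q_pos by (auto simp: y_def less_eq_vec_def less_imp_le)
  have "F y \<le> y"
    unfolding less_eq_vec_def
  proof
    fix i
    show "F y $ i \<le> y $ i"
    proof (cases "i \<in> S")
      case False
      have "F y $ i \<le> F q $ i" using F_mono[OF y] by (auto simp: less_eq_vec_def)
      then show ?thesis using False by (simp add: q_fix y_def)
    next
      case True
      with lin have i: "i \<notin> quad" "(\<Sum>j\<in>UNIV. p i j) + c i = 1" by auto
      \<comment> \<open>By closedness, row \<open>i\<close> only sees variables of \<open>S\<close>,
        where \<open>y\<close> equals \<open>q - s u\<close>.\<close>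
      have "p i j * y $ j = p i j * q $ j - s * (p i j * u $ j)" for j
      proof (cases "p i j = 0")
        case False
        then have "j \<in> S" using closed[OF True] p_nonneg[OF i(1), of j] by force
        then show ?thesis by (simp add: y_def algebra_simps)
      qed simp
      then have "F y $ i = F q $ i - s * DF q u $ i"
        using i(1) by (simp add: F_lin DF_lin sum_subtractf sum_distrib_left)
      moreover have "DF q u $ i = u $ i" using defect_lin[OF i(1), of q] i(2) by simp
      ultimately show ?thesis using True by (simp add: q_fix y_def)
    qed
  qed
  then have "q \<le> y" using y q_le_prefixpoint by blast
  then have "q $ k \<le> y $ k" by (auto simp: less_eq_vec_def)
  then show False using k su(1)[of k] by (simp add: y_def)
qed

text \<open>
  Where \<open>w / u\<close> attains a negative minimum the defect of \<open>u\<close> must vanish, so the minimising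
  indices form a closed stochastic linear subsystem.
\<close>

lemma inverse_nonneg:
  assumes x: "0 \<le> x" "x \<le> q" and w: "DF x w \<le> w"
  shows "0 \<le> w"
proof -
  define m where "m = Min (range (\<lambda>i. w $ i / u $ i))"
  have "m \<in> range (\<lambda>i. w $ i / u $ i)" unfolding m_def by (intro Min_in) auto
  then obtain k where "m = w $ k / u $ k" by blast
  then have k: "w $ k = m * u $ k" using u_pos[of k] by (simp del: vector_minus_component)
  have m: "m * u $ i \<le> w $ i" for i
  proof -
    have "m \<le> w $ i / u $ i" unfolding m_def by (intro Min_le) auto
    then show ?thesis using u_pos[of i] by (simp add: pos_le_divide_eq)
  qed
  have xi: "0 \<le> x $ i" "x $ i \<le> q $ i" for i using x by (auto simp: less_eq_vec_def)
  have m0: "0 \<le> m"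
  proof (rule ccontr)
    assume "\<not> 0 \<le> m"
    then have neg: "m < 0" by simp
    define S where "S = {i. w $ i = m * u $ i}"
    \<comment> \<open>Monotonicity of \<open>DF x\<close> gives
      \<open>m * DF x u \<le> DF x w \<le> w = m * u\<close> in row \<open>i\<close>. Dividing by
      the negative \<open>m\<close> reverses the order, so the defect of \<open>u\<close> is
      nonpositive. A linear row also has nonnegative defect, which closes the chain.\<close>
    have defect: "u $ i - DF x u $ i \<le> 0" "i \<notin> quad \<Longrightarrow> DF x w $ i \<le> m * DF x u $ i" if "i \<in> S" for i
    proof -
      have ge: "m * DF x u $ i \<le> DF x w $ i"
      proof (cases "i \<in> quad")
        case True
        have "x $ l i * (m * u $ r i) \<le> x $ l i * w $ r i" "x $ r i * (m * u $ l i) \<le> x $ r i * w $ l i"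
          using xi m by (auto intro!: mult_left_mono)
        then show ?thesis using True by (simp add: DF_quad algebra_simps)
      next
        case False
        have "(\<Sum>j\<in>UNIV. p i j * (m * u $ j)) \<le> (\<Sum>j\<in>UNIV. p i j * w $ j)"
          using m False by (intro sum_mono mult_left_mono) (auto simp: p_nonneg)
        then show ?thesis using False by (simp add: DF_lin sum_distrib_left algebra_simps)
      qed
      have le: "DF x w $ i \<le> m * u $ i"
        using w that by (auto simp: less_eq_vec_def S_def dest: spec[of _ i])
      with ge have "m * (DF x u $ i) \<le> m * (u $ i)" by (rule order_trans)
      then show "u $ i - DF x u $ i \<le> 0" using neg by (simp del: vector_minus_component)
      show "DF x w $ i \<le> m * DF x u $ i" if "i \<notin> quad"
      proof -
        have "DF x u $ i \<le> u $ i" using defect_lin[OF that, of x] sum_le_1[OF that] by simp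
        then have "m * u $ i \<le> m * DF x u $ i" using neg by (intro mult_left_mono_neg) auto
        with le show ?thesis by linarith
      qed
    qed
    \<comment> \<open>On a product row the term \<open>u $ l i * u $ r i\<close> makes the defect
      strictly positive.\<close>
    have lin: "i \<notin> quad" if "i \<in> S" for i
    proof
      assume i: "i \<in> quad"
      have "0 < u $ l i * u $ r i" "0 \<le> (q - x) $ l i * u $ r i" "0 \<le> u $ l i * (q - x) $ r i"
        using u_pos xi by (auto intro!: mult_nonneg_nonneg mult_pos_pos simp: less_imp_le)
      with defect(1)[OF that] defect_quad[OF i, of x] show False by linarith
    qed
    have "S = {}"
    proof (rule stochastic_closed_empty)
      fix i assume i: "i \<in> S"
      show "i \<notin> quad \<and> (\<Sum>j\<in>UNIV. p i j) + c i = 1"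
        using lin[OF i] defect(1)[OF i] defect_lin[OF lin[OF i], of x] sum_le_1[OF lin[OF i]] by auto
      fix j assume j: "0 < p i j"
      \<comment> \<open>A sum of nonnegative terms that is at most 0 vanishes termwise, so every
        \<open>j\<close> with \<open>p i j > 0\<close> attains the minimum as well: \<open>S\<close>
        is closed.\<close>
      have "(\<Sum>j\<in>UNIV. p i j * (w $ j - m * u $ j)) = DF x w $ i - m * DF x u $ i"
        using lin[OF i] by (simp add: DF_lin sum_distrib_left sum_subtractf sum.distrib algebra_simps)
      then have "(\<Sum>j\<in>UNIV. p i j * (w $ j - m * u $ j)) \<le> 0"
        using defect(2)[OF i lin[OF i]] by linarith
      moreover have "\<forall>j\<in>UNIV. 0 \<le> p i j * (w $ j - m * u $ j)"
        using m p_nonneg[OF lin[OF i]] by simp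
      ultimately have "(\<Sum>j\<in>UNIV. p i j * (w $ j - m * u $ j)) = 0"
        by (meson order_antisym sum_nonneg)
      then have "p i j * (w $ j - m * u $ j) = 0"
        using \<open>\<forall>j\<in>UNIV. 0 \<le> _\<close> by (subst (asm) sum_nonneg_eq_0_iff) auto
      with j show "j \<in> S" by (simp add: S_def)
    qed
    moreover have "k \<in> S" using k by (simp add: S_def)
    ultimately show False by simp
  qed
  have "0 \<le> w $ i" for i
    using m[of i] mult_nonneg_nonneg[OF m0 less_imp_le[OF u_pos[of i]]] by linarith
  then show ?thesis by (simp add: less_eq_vec_def)
qed

text \<open>For a kernel vector \<open>w\<close>, \<open>inverse_nonneg\<close> applies to both
  \<open>w\<close> and \<open>- w\<close>; a square matrix with trivial kernel is
  invertible.\<close>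

lemma invertible_newton_matrix:
  assumes x: "0 \<le> x" "x \<le> q"
  shows "invertible (mat 1 - jacobian F (at x))"
  unfolding invertible_left_inverse matrix_left_invertible_ker
proof (intro allI impI)
  fix w assume "(mat 1 - jacobian F (at x)) *v w = 0"
  then have w: "DF x w = w"
    by (simp add: matrix_vector_mult_diff_rdistrib jacobian_F)
  then have "0 \<le> w" "0 \<le> - w"
    using inverse_nonneg[OF x, of w] inverse_nonneg[OF x, of "- w"]
    by (simp_all add: linear_neg[OF linear_DF])
  then show "w = 0" by (simp add: less_eq_vec_def vec_eq_iff) (meson order_antisym)
qed

section \<open>The Newton operator and its convergence in units of \<open>u\<close>\<close>

definition newton :: "real ^ 'n \<Rightarrow> real ^ 'n" where
  "newton x = x + matrix_inv (mat 1 - jacobian F (at x)) *v (F x - x)"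

lemma newton_equation:
  assumes x: "0 \<le> x" "x \<le> q"
  shows "newton x - x - DF x (newton x - x) = F x - x"
proof -
  let ?A = "mat 1 - jacobian F (at x)"
  have "?A ** matrix_inv ?A = mat 1"
    using invertible_newton_matrix[OF x] unfolding invertible_def matrix_inv_def
    by (metis (mono_tags, lifting) someI_ex)
  then have "?A *v (matrix_inv ?A *v (F x - x)) = F x - x"
    by (simp add: matrix_vector_mul_assoc)
  then show ?thesis
    by (simp add: newton_def matrix_vector_mult_diff_rdistrib jacobian_F)
qed

text \<open>Subtracting the linearised equation solved by the Newton step from the exact expansion
  of \<open>F q = q\<close> at \<open>x\<close> leaves only the second-order remainder.\<close>

lemma newton_defect:
  assumes x: "0 \<le> x" "x \<le> q"
  shows "(q - newton x) $ i - DF x (q - newton x) $ i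
    = (if i \<in> quad then (q - x) $ l i * (q - x) $ r i else 0)"
proof -
  have "DF x (q - newton x) = DF x (q - x) - DF x (newton x - x)"
    by (simp flip: linear_diff[OF linear_DF])
  moreover have "F q $ i = F x $ i + DF x (q - x) $ i
      + (if i \<in> quad then (q - x) $ l i * (q - x) $ r i else 0)"
    using F_taylor[of x "q - x" i] by simp
  moreover have "(newton x - x - DF x (newton x - x)) $ i = (F x - x) $ i"
    by (simp only: newton_equation[OF x])
  ultimately show ?thesis by (simp add: q_fix split: if_splits)
qed

lemma newton_le_q:
  assumes x: "0 \<le> x" "x \<le> q"
  shows "newton x \<le> q"
proof -
  have "0 \<le> (q - x) $ i" for i using x by (auto simp: less_eq_vec_def)
  then have "0 \<le> (q - newton x) $ i - DF x (q - newton x) $ i" for i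
    by (simp add: newton_defect[OF x] del: vector_minus_component)
  then have "0 \<le> q - newton x"
    by (intro inverse_nonneg[OF x]) (simp add: less_eq_vec_def)
  then show ?thesis by simp
qed

text \<open>The condition \<open>x \<le> F x\<close> makes the right-hand side of the Newton
  equation nonnegative, hence also the step \<open>h\<close>. Then \<open>F (newton x)\<close>
  exceeds \<open>newton x\<close> exactly by the second-order remainder in \<open>h\<close>, so the
  condition is inherited.\<close>

lemma newton_ge:
  assumes x: "0 \<le> x" "x \<le> q" "x \<le> F x"
  shows "x \<le> newton x" "newton x \<le> F (newton x)"
proof -
  let ?h = "newton x - x"
  have eq: "?h - DF x ?h = F x - x" using newton_equation x by blast
  have "DF x ?h \<le> ?h"
    using x(3) eq by (metis diff_ge_0_iff_ge)
  then have h: "0 \<le> ?h" by (rule inverse_nonneg[OF x(1,2)])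
  then show "x \<le> newton x" by simp
  show "newton x \<le> F (newton x)"
    unfolding less_eq_vec_def
  proof
    fix i
    have "F (newton x) $ i = F x $ i + DF x ?h $ i + (if i \<in> quad then ?h $ l i * ?h $ r i else 0)"
      using F_taylor[of x ?h i] by simp
    moreover have "(?h - DF x ?h) $ i = (F x - x) $ i" by (simp only: eq)
    moreover have "0 \<le> (if i \<in> quad then ?h $ l i * ?h $ r i else 0)"
      using h by (auto simp: less_eq_vec_def)
    ultimately show "newton x $ i \<le> F (newton x) $ i" by simp
  qed
qed

text \<open>By \<open>inverse_nonneg\<close> it suffices to compare the images of
  \<open>t *\<^sub>R u\<close> and of the new error under \<open>I - B(x)\<close>, both of which are
  known row by row.\<close>

lemma newton_error:
  assumes x: "0 \<le> x" "x \<le> q" and lam: "0 < lam" "q - x \<le> lam *\<^sub>R u"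
  shows "q - newton x \<le> (lam\<^sup>2 / (1 + 2 * lam)) *\<^sub>R u"
proof -
  define t where "t = lam\<^sup>2 / (1 + 2 * lam)"
  let ?w = "t *\<^sub>R u - (q - newton x)"
  have t: "0 \<le> t" "t * (1 + 2 * lam) = lam\<^sup>2" using lam by (auto simp: t_def)
  have "0 \<le> ?w $ i - DF x ?w $ i" for i
  proof -
    have DF: "DF x ?w = t *\<^sub>R DF x u - DF x (q - newton x)"
      by (simp only: linear_diff[OF linear_DF] linear_scale[OF linear_DF])
    have *: "?w $ i - DF x ?w $ i
      = t * (u $ i - DF x u $ i) - ((q - newton x) $ i - DF x (q - newton x) $ i)"
      unfolding DF by (simp add: algebra_simps)
    show ?thesis
    proof (cases "i \<in> quad")
      case False
      then show ?thesis
        unfolding * newton_defect[OF x] defect_lin[OF False] using t(1) sum_le_1[OF False] by simp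
    next
      case True
      define a b where "a = (q - x) $ l i" and "b = (q - x) $ r i"
      define v w where "v = u $ l i" and "w = u $ r i"
      have vw: "0 < v" "0 < w" by (simp_all only: v_def w_def u_pos)
      have ab: "0 \<le> a" "0 \<le> b" "a \<le> lam * v" "b \<le> lam * w"
        using x lam(2) by (simp_all add: less_eq_vec_def a_def b_def v_def w_def)
      \<comment> \<open>The products \<open>v * w\<close>, \<open>a * w\<close> and
        \<open>v * b\<close> are bounded below by \<open>a * b\<close> divided by
        \<open>lam\<^sup>2\<close>, \<open>lam\<close> and \<open>lam\<close>. Adding these yields
        the factor \<open>t\<close>; equality holds for \<open>a = lam * v\<close>,
        \<open>b = lam * w\<close>.\<close>
      have "a * b * (1 + 2 * lam) \<le> lam\<^sup>2 * (v * w + a * w + v * b)"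
      proof -
        have "a * b \<le> lam\<^sup>2 * (v * w)"
          using mult_mono[OF ab(3,4)] ab vw lam by (simp add: power2_eq_square algebra_simps)
        moreover have "a * b \<le> a * (lam * w)" "a * b \<le> (lam * v) * b"
          using ab by (auto intro: mult_left_mono mult_right_mono)
        then have "lam * (a * b) \<le> lam * (a * (lam * w))" "lam * (a * b) \<le> lam * ((lam * v) * b)"
          using lam(1) by (auto intro: mult_left_mono simp del: mult_le_cancel_left_pos)
        ultimately show ?thesis by (simp add: power2_eq_square algebra_simps)
      qed
      then have "a * b \<le> t * (v * w + a * w + v * b)"
        using lam(1) by (simp add: t_def field_simps)
      then show ?thesis
        unfolding * newton_defect[OF x] defect_quad[OF True]
        using True by (simp only: a_def b_def v_def w_def if_True)
    qed
  qed
  then have "0 \<le> ?w"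
    by (intro inverse_nonneg[OF x]) (auto simp: less_eq_vec_def)
  then show ?thesis by (simp add: t_def)
qed

text \<open>The third conjunct is carried along because it makes the Newton steps nonnegative; it
  holds initially since \<open>F 0\<close> is nonnegative.\<close>

lemma newton_iterate_invariant:
  "0 \<le> (newton ^^ k) 0 \<and> (newton ^^ k) 0 \<le> q \<and> (newton ^^ k) 0 \<le> F ((newton ^^ k) 0)"
proof (induction k)
  case 0
  show ?case using q_pos by (auto simp: F_nonneg) (auto simp: less_eq_vec_def less_imp_le)
next
  case (Suc k)
  then show ?case using newton_ge newton_le_q by (auto intro: order_trans)
qed

lemma scaleR_u_mono: "s \<le> t \<Longrightarrow> s *\<^sub>R u \<le> t *\<^sub>R u"
  using u_pos by (auto simp: less_eq_vec_def intro!: mult_right_mono less_imp_le)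

text \<open>The halving phase: \<open>lam\<^sup>2 / (1 + 2 * lam) \<le> lam / 2\<close> holds for
  every positive \<open>lam\<close>, however large the initial ratio.\<close>

lemma newton_iterate_error_linear:
  assumes L: "0 < L" "q \<le> L *\<^sub>R u"
  shows "q - (newton ^^ k) 0 \<le> (L / 2 ^ k) *\<^sub>R u"
proof (induction k)
  case 0
  show ?case using L by simp
next
  case (Suc k)
  let ?lam = "L / 2 ^ k"
  have lam: "0 < ?lam" using L by simp
  have "q - newton ((newton ^^ k) 0) \<le> (?lam\<^sup>2 / (1 + 2 * ?lam)) *\<^sub>R u"
    using newton_iterate_invariant[of k] by (intro newton_error lam Suc) auto
  moreover have "?lam\<^sup>2 / (1 + 2 * ?lam) \<le> ?lam / 2"
  proof -
    have "a\<^sup>2 / (1 + 2 * a) \<le> a / 2" if "0 < a" for a :: real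
      using that by (simp add: field_simps power2_eq_square)
    then show ?thesis using lam by blast
  qed
  ultimately show ?case
    using scaleR_u_mono[of "?lam\<^sup>2 / (1 + 2 * ?lam)" "?lam / 2"]
    by (auto simp: mult.commute intro: order_trans)
qed

text \<open>The squaring phase, which pays off once halving has brought \<open>lam\<close> below
  1.\<close>

lemma newton_iterate_error_quadratic:
  assumes lam: "0 < lam" "q - (newton ^^ k) 0 \<le> lam *\<^sub>R u"
  shows "q - (newton ^^ (k + m)) 0 \<le> (lam ^ (2 ^ m)) *\<^sub>R u"
proof (induction m)
  case 0
  show ?case using lam by simp
next
  case (Suc m)
  let ?lam = "lam ^ (2 ^ m)"
  have l: "0 < ?lam" using lam by simp
  have "q - newton ((newton ^^ (k + m)) 0) \<le> (?lam\<^sup>2 / (1 + 2 * ?lam)) *\<^sub>R u"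
    using newton_iterate_invariant[of "k + m"] by (intro newton_error l Suc) auto
  moreover have "?lam\<^sup>2 / (1 + 2 * ?lam) \<le> ?lam\<^sup>2"
    using l by (simp add: divide_le_eq mult_le_cancel_left1)
  ultimately show ?case
    using scaleR_u_mono[of "?lam\<^sup>2 / (1 + 2 * ?lam)" "?lam\<^sup>2"]
    by (auto simp: mult.commute simp flip: power_mult intro: order_trans)
qed

end

section \<open>A lower bound on the distance of the least fixpoint from 1\<close>

context quadratic_linear_lfp
begin

text \<open>The row conditions are \<open>F (1 - y) \<le> 1 - y\<close> rewritten in
  \<open>y\<close>; the bracket added on a linear row is its deficit
  \<open>1 - P i (1)\<close>.\<close>

lemma u_ge_of_prefixpoint:
  assumes y: "\<And>i. 0 \<le> y $ i" "\<And>i. y $ i \<le> 1"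
    and quad: "\<And>i. i \<in> quad \<Longrightarrow> y $ i + y $ l i * y $ r i \<le> y $ l i + y $ r i"
    and lin: "\<And>i. i \<notin> quad \<Longrightarrow> y $ i \<le> (\<Sum>j\<in>UNIV. p i j * y $ j) + (1 - ((\<Sum>j\<in>UNIV. p i j) + c i))"
  shows "y \<le> u"
proof -
  have "F (1 - y) \<le> 1 - y"
    unfolding less_eq_vec_def
  proof
    fix i
    show "F (1 - y) $ i \<le> (1 - y) $ i"
      using quad[of i] lin[of i]
      by (cases "i \<in> quad") (simp_all add: F_quad F_lin algebra_simps sum_subtractf)
  qed
  moreover have "0 \<le> 1 - y" using y(2) by (simp add: less_eq_vec_def)
  ultimately have "q \<le> 1 - y" by (intro q_le_prefixpoint)
  then show ?thesis by (simp add: less_eq_vec_def algebra_simps)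
qed

lemma u_lower_bound:
  assumes den: "\<And>i. i \<notin> quad \<Longrightarrow> 1 \<le> den i" "\<And>i. i \<notin> quad \<Longrightarrow> den i \<in> \<int>"
      "\<And>i j. i \<notin> quad \<Longrightarrow> den i * p i j \<in> \<int>" "\<And>i. i \<notin> quad \<Longrightarrow> den i * c i \<in> \<int>"
    and D: "(\<Prod>i\<in>UNIV. 2 * (if i \<in> quad then 4 else 2 * den i)) \<le> D"
      "\<And>i. i \<notin> quad \<Longrightarrow> den i \<le> D" "1 \<le> D"
  shows "1 / D\<^sup>2 \<le> u $ i"
proof -
  define leaky where "leaky i \<longleftrightarrow> i \<notin> quad \<and> (\<Sum>j\<in>UNIV. p i j) + c i < 1" for i
  \<comment> \<open>Index \<open>(True, i)\<close> carries \<open>v i \<ge> 1\<close>, index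
    \<open>(False, i)\<close> the constraint of row \<open>i\<close>. A leaky row imposes nothing of
    its own, so it repeats \<open>v i \<ge> 1\<close>. Multiplying by \<open>den i\<close> makes the
    coefficients integral.\<close>
  define a :: "bool \<times> 'n \<Rightarrow> real ^ 'n" where
    "a = (\<lambda>(e, i). if e \<or> leaky i then axis i 1
       else if i \<in> quad then axis (l i) 1 + axis (r i) 1 - axis i 1
       else den i *\<^sub>R ((\<chi> j. p i j) - axis i 1))"
  define b :: "bool \<times> 'n \<Rightarrow> real" where
    "b = (\<lambda>(e, i). if e \<or> leaky i \<or> i \<in> quad then 1 else 0)"
  \<comment> \<open>Absolute row sum plus right-hand side: 1 + 1 for \<open>v i \<ge> 1\<close>, 3 +
    1 for a product row, and at most \<open>2 * den i\<close> for a linear row, since its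
    coefficients sum to at most 1. A repeated constraint on a leaky row fits because
    \<open>den i \<ge> 1\<close>.\<close>
  define W :: "bool \<times> 'n \<Rightarrow> real" where
    "W = (\<lambda>(e, i). if e then 2 else if i \<in> quad then 4 else 2 * den i)"
  define m where "m = Min (range (\<lambda>i. u $ i))"
  have m: "0 < m" "\<And>i. m \<le> u $ i"
    unfolding m_def using u_pos by (simp_all add: Min_gr_iff del: vector_minus_component)
  have m1: "m \<le> 1" using m(2) u_le_1 order_trans by blast
  have m2: "m\<^sup>2 \<le> m" using m(1) m1 by (simp add: power2_eq_square mult_le_cancel_left1)
  \<comment> \<open>On a product row \<open>u l + u r - u i = u l * u r \<ge> m\<^sup>2\<close>, so
    this scaling lifts the slack to 1; as \<open>m \<le> 1\<close>, it also lifts the entries of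
    \<open>u\<close> to at least 1.\<close>
  define v0 where "v0 = (1 / m\<^sup>2) *\<^sub>R u"
  have axis_dot: "axis i (1 :: real) \<bullet> v = v $ i" for i :: 'n and v
    by (simp add: inner_axis')
  have a_axis: "a (True, i) \<bullet> v = v $ i" "leaky i \<Longrightarrow> a (e, i) \<bullet> v = v $ i" for e i v
    by (simp_all add: a_def axis_dot)
  have a_quad: "a (False, i) \<bullet> v = v $ l i + v $ r i - v $ i" if "i \<in> quad" for i v
    using that by (simp add: a_def leaky_def inner_add_left inner_diff_left axis_dot)
  have a_lin: "a (False, i) \<bullet> v = den i * ((\<Sum>j\<in>UNIV. p i j * v $ j) - v $ i)"
    if "i \<notin> quad" "\<not> leaky i" for i v
  proof -
    have "(\<chi> j. p i j) \<bullet> v = (\<Sum>j\<in>UNIV. p i j * v $ j)" by (simp add: inner_vec_def)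
    then show ?thesis using that by (simp add: a_def inner_diff_left axis_dot)
  qed
  have v0_ge: "1 \<le> v0 $ i" for i
    using m(1) m(2)[of i] m2 by (simp add: v0_def le_divide_eq_1_pos del: vector_minus_component)
  have feas: "b k \<le> a k \<bullet> v0" for k
  proof (cases k)
    case (Pair e i)
    consider "e \<or> leaky i" | "\<not> e" "i \<in> quad" | "\<not> e" "i \<notin> quad" "\<not> leaky i"
      by blast
    then show ?thesis
    proof cases
      case 1
      then show ?thesis using v0_ge[of i] a_axis Pair by (auto simp: b_def)
    next
      case 2
      have "DF q u $ i = u $ l i + u $ r i - 2 * (u $ l i * u $ r i)"
        using 2 by (simp add: DF_quad algebra_simps)
      then have "u $ l i + u $ r i - u $ i = u $ l i * u $ r i"
        using defect_quad[OF 2(2), of q] by simp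
      moreover have "m * m \<le> u $ l i * u $ r i"
        using m by (intro mult_mono) (auto simp: less_imp_le simp del: vector_minus_component
            intro: order_trans[OF less_imp_le])
      ultimately have "m\<^sup>2 \<le> u $ l i + u $ r i - u $ i"
        by (simp add: power2_eq_square)
      then have "1 \<le> (1 / m\<^sup>2) * (u $ l i + u $ r i - u $ i)"
        using m(1) by (simp add: le_divide_eq_1_pos del: vector_minus_component)
      then show ?thesis
        using 2 Pair a_quad[OF 2(2), of v0] by (simp add: b_def v0_def algebra_simps diff_divide_distrib add_divide_distrib)
    next
      case 3
      then have "(\<Sum>j\<in>UNIV. p i j) + c i = 1"
        using sum_le_1[OF 3(2)] by (auto simp: leaky_def)
      then have "(\<Sum>j\<in>UNIV. p i j * u $ j) = u $ i"
        using defect_lin[OF 3(2), of q] DF_lin[OF 3(2), of q u] by simp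
      then have "(\<Sum>j\<in>UNIV. p i j * v0 $ j) = v0 $ i"
        by (simp add: v0_def flip: sum_divide_distrib del: vector_minus_component)
      then show ?thesis using 3 Pair a_lin by (simp add: b_def)
    qed
  qed
  have sum_axis: "(\<Sum>j\<in>UNIV. \<bar>axis i (1 :: real) $ j\<bar>) = 1" for i :: 'n
    by (simp add: axis_def if_distrib[of abs] cong: if_cong)
  have axis_int: "axis i (1 :: real) $ j \<in> \<int>" for i j :: 'n
    by (simp add: axis_def)
  have aint: "a k $ j \<in> \<int>" for k j
  proof (cases k)
    case (Pair e i)
    have "den i * (p i j - axis i 1 $ j) \<in> \<int>" if "i \<notin> quad"
      unfolding right_diff_distrib using den that axis_int by auto
    then show ?thesis
      using axis_int Pair by (auto simp: a_def)
  qed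
  have Wk: "(\<Sum>j\<in>UNIV. \<bar>a k $ j\<bar>) + \<bar>b k\<bar> \<le> W k" for k
  proof (cases k)
    case (Pair e i)
    consider "e \<or> leaky i" | "\<not> e" "i \<in> quad" | "\<not> e" "i \<notin> quad" "\<not> leaky i"
      by blast
    then show ?thesis
    proof cases
      case 1
      then have "2 \<le> W k" using den(1)[of i] Pair by (auto simp: W_def leaky_def)
      then show ?thesis using 1 Pair by (auto simp: a_def b_def sum_axis)
    next
      case 2
      have "(\<Sum>j\<in>UNIV. \<bar>a k $ j\<bar>)
        \<le> (\<Sum>j\<in>UNIV. \<bar>axis (l i) (1 :: real) $ j\<bar> + \<bar>axis (r i) (1 :: real) $ j\<bar> + \<bar>axis i (1 :: real) $ j\<bar>)"
        using 2 Pair by (intro sum_mono) (auto simp: a_def leaky_def)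
      also have "\<dots> = 3" by (simp add: sum.distrib sum_axis)
      finally show ?thesis using 2 Pair by (simp add: b_def W_def)
    next
      case 3
      have d: "1 \<le> den i" using den 3 by simp
      have "(\<Sum>j\<in>UNIV. \<bar>a k $ j\<bar>) \<le> (\<Sum>j\<in>UNIV. den i * (p i j + \<bar>axis i (1 :: real) $ j\<bar>))"
      proof (intro sum_mono)
        fix j
        have "\<bar>p i j - axis i 1 $ j\<bar> \<le> p i j + \<bar>axis i (1 :: real) $ j\<bar>"
          using p_nonneg[OF 3(2), of j] by linarith
        then show "\<bar>a k $ j\<bar> \<le> den i * (p i j + \<bar>axis i (1 :: real) $ j\<bar>)"
          using d 3 Pair by (simp add: a_def abs_mult mult_left_mono)
      qed
      also have "\<dots> = den i * ((\<Sum>j\<in>UNIV. p i j) + 1)"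
        by (simp add: sum.distrib sum_axis flip: sum_distrib_left)
      also have "\<dots> \<le> den i * 2"
        using d sum_le_1[OF 3(2)] c_nonneg[OF 3(2)] by (intro mult_left_mono) auto
      finally show ?thesis using 3 Pair by (simp add: b_def W_def)
    qed
  qed
  have W1: "1 \<le> W k" for k
    using den(1)[of "snd k"] by (auto simp: W_def split: prod.split)
  have v_ge: "1 \<le> v $ i" if "\<And>k. b k \<le> a k \<bullet> v" for v i
    using that[of "(True, i)"] by (simp add: a_axis) (simp add: b_def)
  obtain v where v: "\<And>k. b k \<le> a k \<bullet> v" and vW: "\<And>i. \<bar>v $ i\<bar> \<le> (\<Prod>k\<in>UNIV. W k)"
  proof (rule integer_polyhedron_small_point[of UNIV b a v0 W])
    show "0 \<le> v" if "\<And>k. k \<in> UNIV \<Longrightarrow> b k \<le> a k \<bullet> v" for v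
      using v_ge[of v] that by (force simp: less_eq_vec_def intro: order_trans[OF zero_le_one])
  qed (use feas aint Wk W1 in auto)
  have "(\<Prod>k\<in>UNIV. W k) = (\<Prod>e\<in>UNIV. \<Prod>i\<in>UNIV. W (e, i))"
    by (subst prod.cartesian_product) (simp flip: UNIV_Times_UNIV)
  also have "\<dots> = (\<Prod>i\<in>UNIV. 2 * (if i \<in> quad then 4 else 2 * den i))"
    by (simp add: UNIV_bool W_def prod.distrib mult.commute)
  finally have vD: "v $ i \<le> D" for i
    using vW[of i] D(1) by linarith
  have v1: "1 \<le> v $ i" for i using v_ge v by blast
  \<comment> \<open>With this scaling \<open>y \<le> 1 / D\<close>, so the quadratic term of a
    product row is at most \<open>1 / D\<^sup>2\<close>, which is just the slack left by the linear
    constraint. From \<open>v \<ge> 1\<close> one gets \<open>y \<ge> 1 / D\<^sup>2\<close>.\<close>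
  define y where "y = (1 / D\<^sup>2) *\<^sub>R v"
  have yi: "y $ i = v $ i / D\<^sup>2" for i by (simp add: y_def)
  have D2: "D \<le> D\<^sup>2" "0 < D\<^sup>2" using D(3) by (auto simp: power2_eq_square)
  have yD: "0 \<le> y $ i" "y $ i \<le> 1 / D" "y $ i \<le> 1" for i
  proof -
    have "v $ i / D\<^sup>2 \<le> D / D\<^sup>2" using vD D2(2) by (intro divide_right_mono) auto
    also have "D / D\<^sup>2 = 1 / D" using D(3) by (simp add: power2_eq_square)
    finally show "y $ i \<le> 1 / D" by (simp add: yi)
    also have "\<dots> \<le> 1" using D(3) by simp
    finally show "y $ i \<le> 1" .
    show "0 \<le> y $ i" using v1[of i] by (auto simp: yi)
  qed
  have "y \<le> u"
  proof (rule u_ge_of_prefixpoint)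
    fix i assume i: "i \<in> quad"
    have "1 \<le> v $ l i + v $ r i - v $ i"
      using v[of "(False, i)"] i by (simp add: a_quad) (simp add: b_def)
    then have "1 / D\<^sup>2 \<le> y $ l i + y $ r i - y $ i"
      using D2(2) by (simp add: yi divide_right_mono flip: add_divide_distrib diff_divide_distrib)
    moreover have "y $ l i * y $ r i \<le> (1 / D) * (1 / D)"
      using yD D(3) by (intro mult_mono) auto
    ultimately show "y $ i + y $ l i * y $ r i \<le> y $ l i + y $ r i"
      by (simp add: power2_eq_square)
  next
    fix i assume i: "i \<notin> quad"
    define \<delta> where "\<delta> = 1 - ((\<Sum>j\<in>UNIV. p i j) + c i)"
    have "0 \<le> \<delta>" using sum_le_1[OF i] by (simp add: \<delta>_def)
    have "y $ i \<le> (\<Sum>j\<in>UNIV. p i j * y $ j) + \<delta>"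
    proof (cases "leaky i")
      case False
      have "0 \<le> den i * ((\<Sum>j\<in>UNIV. p i j * v $ j) - v $ i)"
        using v[of "(False, i)"] i False by (simp add: a_lin) (simp add: b_def)
      then have "v $ i \<le> (\<Sum>j\<in>UNIV. p i j * v $ j)"
        using den(1)[OF i] by (simp add: zero_le_mult_iff)
      then have "y $ i \<le> (\<Sum>j\<in>UNIV. p i j * y $ j)"
        using D2(2) by (simp add: yi divide_right_mono flip: sum_divide_distrib)
      then show ?thesis using \<open>0 \<le> \<delta>\<close> by linarith
    next
      case True
      \<comment> \<open>The deficit of a leaky row is a positive multiple of
        \<open>1 / den i\<close>, so it is at least \<open>1 / D\<close> and alone dominates
        \<open>y i\<close>.\<close>
      then have "0 < den i * \<delta>" using den(1)[OF i] by (simp add: leaky_def \<delta>_def)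
      moreover have "den i * \<delta> \<in> \<int>"
        unfolding \<delta>_def right_diff_distrib distrib_left sum_distrib_left
        using den(2-4)[OF i] by (auto intro!: Ints_diff Ints_add Ints_sum)
      ultimately have "1 \<le> den i * \<delta>"
        using Ints_nonzero_abs_ge1[of "den i * \<delta>"] by linarith
      also have "\<dots> \<le> D * \<delta>" using D(2)[OF i] \<open>0 \<le> \<delta>\<close> by (intro mult_right_mono)
      finally have "1 / D \<le> \<delta>" using D(3) by (simp add: divide_le_eq mult.commute)
      moreover have "0 \<le> (\<Sum>j\<in>UNIV. p i j * y $ j)"
        using p_nonneg[OF i] yD(1) by (intro sum_nonneg mult_nonneg_nonneg)
      ultimately show ?thesis using yD(2)[of i] by linarith
    qed
    then show "y $ i \<le> (\<Sum>j\<in>UNIV. p i j * y $ j) + (1 - ((\<Sum>j\<in>UNIV. p i j) + c i))"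
      by (simp add: \<delta>_def)
  qed (use yD in auto)
  moreover have "1 / D\<^sup>2 \<le> y $ i" using v1[of i] D2(2) by (simp add: yi divide_right_mono)
  ultimately show ?thesis by (auto simp: less_eq_vec_def intro: order_trans)
qed

end

section \<open>Polynomials in simple normal form\<close>

text \<open>Keys can cancel in a sum of polynomials; a common finite index set allows termwise
  addition.\<close>

lemma poly_eval_superset:
  assumes "finite S" "Poly_Mapping.keys f \<subseteq> S"
  shows "poly_eval f x = (\<Sum>m\<in>S. of_rat (Poly_Mapping.lookup f m) *
    (\<Prod>j\<in>UNIV. (x $ j) ^ Poly_Mapping.lookup m j))"
  unfolding poly_eval_def using assms by (intro sum.mono_neutral_left) (auto simp: in_keys_iff)

lemma poly_eval_add: "poly_eval (f + g) x = poly_eval f x + poly_eval g x"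
proof -
  let ?S = "Poly_Mapping.keys f \<union> Poly_Mapping.keys g"
  have "Poly_Mapping.keys (f + g) \<subseteq> ?S" by (rule Poly_Mapping.keys_add)
  then show ?thesis
    by (simp add: poly_eval_superset[of ?S] lookup_add of_rat_add distrib_right sum.distrib)
qed

lemma poly_eval_sum: "poly_eval (\<Sum>j\<in>A. f j) x = (\<Sum>j\<in>A. poly_eval (f j) x)"
proof (induction A rule: infinite_finite_induct)
  case (insert a A)
  then show ?case by (simp add: poly_eval_add)
qed (simp_all add: poly_eval_def)

lemma poly_eval_single:
  "poly_eval (Poly_Mapping.single m a) x = of_rat a * (\<Prod>j\<in>UNIV. (x $ j) ^ Poly_Mapping.lookup m j)"
  by (subst poly_eval_superset[of "{m}"]) auto

lemma prod_power_lookup_single: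
  fixes x :: "real ^ 'n"
  shows "(\<Prod>j\<in>UNIV. (x $ j) ^ Poly_Mapping.lookup (Poly_Mapping.single k (1 :: nat)) j) = x $ k"
proof -
  have "(\<Prod>j\<in>UNIV. (x $ j) ^ Poly_Mapping.lookup (Poly_Mapping.single k (1 :: nat)) j)
    = (\<Prod>j\<in>UNIV. if j = k then x $ j else 1)"
    by (intro prod.cong refl) (auto simp: lookup_single when_def)
  then show ?thesis by simp
qed

lemma poly_eval_var_mult_var: "poly_eval (poly_var j * poly_var k) x = x $ j * x $ k"
  using prod_power_lookup_single[of x j] prod_power_lookup_single[of x k]
  by (simp add: poly_var_def mult_single poly_eval_single lookup_add power_add prod.distrib)

lemma const_mult_var:
  "poly_const a * poly_var j = Poly_Mapping.single (Poly_Mapping.single j 1) a"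
  by (simp add: poly_const_def poly_var_def mult_single)

lemma poly_eval_linear:
  "poly_eval ((\<Sum>j\<in>UNIV. poly_const (p j) * poly_var j) + poly_const p0) x
    = (\<Sum>j\<in>UNIV. of_rat (p j) * x $ j) + of_rat p0"
proof -
  have "poly_eval (poly_const (p j) * poly_var j) x = of_rat (p j) * x $ j" for j
    using prod_power_lookup_single[of x j] by (simp add: const_mult_var poly_eval_single)
  then show ?thesis
    by (simp add: poly_eval_add poly_eval_sum) (simp add: poly_const_def poly_eval_single)
qed

text \<open>The monomials \<open>x j\<close> and 1 are pairwise distinct, so the coefficient
  functions of a linear row can be read off the polynomial; sign and size conditions on its
  coefficients then transfer to them.\<close>

lemma lookup_linear:
  fixes p :: "'n::finite \<Rightarrow> rat" and p0 :: rat
  defines "f \<equiv> (\<Sum>j\<in>UNIV. poly_const (p j) * poly_var j) + poly_const p0"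
  shows "Poly_Mapping.lookup f (Poly_Mapping.single k 1) = p k"
    and "Poly_Mapping.lookup f 0 = p0"
proof -
  have f: "f = (\<Sum>j\<in>UNIV. Poly_Mapping.single (Poly_Mapping.single j 1) (p j)) + Poly_Mapping.single 0 p0"
    unfolding f_def const_mult_var by (simp add: poly_const_def)
  have inj: "Poly_Mapping.single j (1::nat) = Poly_Mapping.single k 1 \<longleftrightarrow> j = k" for j k :: 'n
    by (metis lookup_single_eq lookup_single_not_eq zero_neq_one)
  have ne: "Poly_Mapping.single j (1::nat) \<noteq> 0" for j :: 'n
    by (metis lookup_single_eq lookup_zero zero_neq_one)
  show "Poly_Mapping.lookup f (Poly_Mapping.single k 1) = p k"
    unfolding f lookup_add lookup_sum lookup_single using ne[of k, symmetric]
    by (simp only: inj) (simp add: when_def)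
  show "Poly_Mapping.lookup f 0 = p0"
    unfolding f lookup_add lookup_sum lookup_single
    by (simp only: ne) simp
qed

section \<open>Common denominators and encoding size\<close>

definition poly_denom :: "'n rpoly \<Rightarrow> int" where
  "poly_denom f = (\<Prod>m\<in>Poly_Mapping.keys f. snd (quotient_of (Poly_Mapping.lookup f m)))"

definition poly_size :: "'n rpoly \<Rightarrow> nat" where
  "poly_size f = (\<Sum>m\<in>Poly_Mapping.keys f. rat_bits (Poly_Mapping.lookup f m) +
     (\<Sum>j\<in>Poly_Mapping.keys m. nat (bitlen (int (Poly_Mapping.lookup m j)))))"

lemma sys_size_eq: "sys_size P = CARD('n) + (\<Sum>i\<in>UNIV. poly_size (P i))"
  for P :: "'n::finite \<Rightarrow> 'n rpoly"
  by (simp add: sys_size_def poly_size_def)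

lemma poly_denom_ge_1: "1 \<le> poly_denom f"
  unfolding poly_denom_def using quotient_of_denom_pos' by (intro prod_ge_1) (simp add: int_one_le_iff_zero_less)

text \<open>A denominator \<open>d\<close> is at most 2 to its bit length, and the bit lengths add
  up in the size; hence the plain product of the denominators is small enough as a common
  denominator.\<close>

lemma poly_denom_le: "poly_denom f \<le> 2 ^ poly_size f"
proof -
  have "poly_denom f \<le> (\<Prod>m\<in>Poly_Mapping.keys f. 2 ^ (rat_bits (Poly_Mapping.lookup f m) +
     (\<Sum>j\<in>Poly_Mapping.keys m. nat (bitlen (int (Poly_Mapping.lookup m j))))))"
    unfolding poly_denom_def
  proof (intro prod_mono conjI)
    fix m
    let ?d = "snd (quotient_of (Poly_Mapping.lookup f m))"
    have d: "0 < ?d" by (rule quotient_of_denom_pos')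
    then show "0 \<le> ?d" by simp
    have "?d \<le> 2 ^ nat (bitlen ?d)" using bitlen_bounds[OF d] by simp
    also have "\<dots> \<le> 2 ^ (rat_bits (Poly_Mapping.lookup f m) +
     (\<Sum>j\<in>Poly_Mapping.keys m. nat (bitlen (int (Poly_Mapping.lookup m j)))))"
      by (intro power_increasing) (auto simp: rat_bits_def)
    finally show "?d \<le> \<dots>" .
  qed
  then show ?thesis by (simp add: poly_size_def power_sum)
qed

lemma poly_denom_mult_lookup_int:
  "real_of_int (poly_denom f) * of_rat (Poly_Mapping.lookup f m) \<in> \<int>"
proof (cases "m \<in> Poly_Mapping.keys f")
  case True
  obtain n d where nd: "quotient_of (Poly_Mapping.lookup f m) = (n, d)" by fastforce
  have d: "0 < d" using quotient_of_denom_pos[OF nd] .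
  have "d dvd poly_denom f"
    unfolding poly_denom_def using True nd by (metis dvd_prodI finite_keys snd_conv)
  then obtain e where "poly_denom f = d * e" by blast
  moreover have "of_rat (Poly_Mapping.lookup f m) = real_of_int n / real_of_int d"
    by (simp add: quotient_of_div[OF nd] of_rat_divide)
  ultimately have "real_of_int (poly_denom f) * of_rat (Poly_Mapping.lookup f m) = of_int (e * n)"
    using d by simp
  then show ?thesis by (metis Ints_of_int)
next
  case False
  then show ?thesis by (simp add: in_keys_iff)
qed

text \<open>Needed for product rows: their weight \<open>2 * 4 = 2 ^ 3\<close> has to fit below
  \<open>2 ^ (2 + poly_size f)\<close>.\<close>

lemma poly_size_pos:
  assumes "f \<noteq> 0"
  shows "1 \<le> poly_size f"
proof -
  obtain m where m: "m \<in> Poly_Mapping.keys f" using assms by fastforce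
  have "0 < snd (quotient_of (Poly_Mapping.lookup f m))" by (rule quotient_of_denom_pos')
  then have "0 < nat (bitlen (snd (quotient_of (Poly_Mapping.lookup f m))))"
    using bitlen_bounds by (fastforce simp: bitlen_alt_def)
  then have "0 < rat_bits (Poly_Mapping.lookup f m)" by (simp add: rat_bits_def)
  then have "0 < poly_size f"
    unfolding poly_size_def using m by (intro sum_pos2[of _ m]) auto
  then show ?thesis by simp
qed

lemma var_mult_var_nonzero: "poly_var j * poly_var k \<noteq> (0 :: 'n::finite rpoly)"
  by (metis lookup_single_eq lookup_zero mult_1 mult_single poly_var_def zero_neq_one)

section \<open>Newton iteration\<close>

text \<open>The initial ratio is at most \<open>2 ^ (4 * N)\<close>, because
  \<open>q \<le> 1\<close>. After \<open>32 * N + 2\<close> halvings it is at most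
  \<open>1 / 2 ^ (28 * N + 2)\<close>, and \<open>m\<close> squarings multiply that exponent by
  \<open>2 ^ m\<close>. As \<open>u \<le> 1\<close>, the ratio bounds the error itself.\<close>

lemma (in quadratic_linear_lfp) newton_iterate_error:
  assumes u: "\<And>i. 1 / 2 ^ (4 * N) \<le> u $ i"
  shows "infnorm (q - (newton ^^ (32 * N + 2 + m)) 0) \<le> 1 / 2 ^ ((28 * N + 2) * 2 ^ m)"
proof -
  let ?L = "2 ^ (4 * N) :: real"
  define x where "x = (newton ^^ (32 * N + 2 + m)) 0"
  have "q $ i \<le> ?L * u $ i" for i
  proof -
    have "q $ i \<le> 1" using q_less_1[of i] by simp
    also have "1 \<le> ?L * u $ i" using u[of i] by (simp add: divide_le_eq mult.commute)
    finally show ?thesis .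
  qed
  then have "q \<le> ?L *\<^sub>R u" by (simp add: less_eq_vec_def)
  then have "q - (newton ^^ (32 * N + 2)) 0 \<le> (?L / 2 ^ (32 * N + 2)) *\<^sub>R u"
    by (intro newton_iterate_error_linear) auto
  moreover have "?L / 2 ^ (32 * N + 2) = 1 / 2 ^ (28 * N + 2)"
    by (simp add: field_simps flip: power_add)
  ultimately have "q - x \<le> ((1 / 2 ^ (28 * N + 2)) ^ (2 ^ m)) *\<^sub>R u"
    unfolding x_def by (intro newton_iterate_error_quadratic) auto
  then have le: "q - x \<le> (1 / 2 ^ ((28 * N + 2) * 2 ^ m)) *\<^sub>R u"
    by (simp only: power_one_over flip: power_mult)
  have "\<bar>(q - x) $ i\<bar> \<le> 1 / 2 ^ ((28 * N + 2) * 2 ^ m)" for i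
  proof -
    have "0 \<le> (q - x) $ i"
      using newton_iterate_invariant[of "32 * N + 2 + m"] by (auto simp: x_def less_eq_vec_def)
    moreover have "(q - x) $ i \<le> 1 / 2 ^ ((28 * N + 2) * 2 ^ m) * u $ i"
      using le by (simp add: less_eq_vec_def)
    moreover have "\<dots> \<le> 1 / 2 ^ ((28 * N + 2) * 2 ^ m) * 1"
      using u_le_1 by (intro mult_left_mono) auto
    ultimately show ?thesis by linarith
  qed
  then show ?thesis
    unfolding infnorm_def x_def[symmetric]
    by (intro cSup_least) (auto simp: Basis_vec_def inner_axis)
qed

text \<open>Invertibility at every iterate is part of the conclusion: as \<open>matrix_inv\<close>
  is total, it certifies that \<open>newton_iter\<close> is the genuine Newton sequence.\<close>

theorem theoremC4:
  fixes P :: "'n::finite \<Rightarrow> 'n rpoly" and q :: "real ^ 'n" and i :: nat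
  assumes "is_PPS P"
    and "simple_normal_form P"
    and "is_LFP P q"
    and "\<forall>j. 0 < q $ j \<and> q $ j < 1"
    and "i \<ge> 1"
  shows "(\<forall>k. invertible (mat 1 - sys_jacobian P (newton_iter P k)))
    \<and> infnorm (q - newton_iter P (32 * sys_size P + 2 + 2 * i))
        \<le> 1 / 2 ^ ((28 * sys_size P + 2) * 2 ^ i)
    \<and> (1 :: real) / 2 ^ ((28 * sys_size P + 2) * 2 ^ i) \<le> 1 / 2 ^ (2 ^ i)"
proof -
  define quad where "quad = {i. \<exists>j k. P i = poly_var j * poly_var k}"
  have "\<forall>i. \<exists>j k. i \<in> quad \<longrightarrow> P i = poly_var j * poly_var k" by (auto simp: quad_def)
  then obtain l r where lr: "\<And>i. i \<in> quad \<Longrightarrow> P i = poly_var (l i) * poly_var (r i)" by metis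
  have "\<forall>i. \<exists>p p0. i \<notin> quad \<longrightarrow> P i = (\<Sum>j\<in>UNIV. poly_const (p j) * poly_var j) + poly_const p0"
    using assms(2) unfolding quad_def simple_normal_form_def by blast
  then obtain p p0 where lin: "\<And>i. i \<notin> quad \<Longrightarrow>
      P i = (\<Sum>j\<in>UNIV. poly_const (p i j) * poly_var j) + poly_const (p0 i)" by metis
  have lookup: "p i j = Poly_Mapping.lookup (P i) (Poly_Mapping.single j 1)"
    "p0 i = Poly_Mapping.lookup (P i) 0" if "i \<notin> quad" for i j
    using lookup_linear lin[OF that] by metis+
  have nonneg: "0 \<le> Poly_Mapping.lookup (P i) m" for i m
    using assms(1) by (simp add: is_PPS_def)
  \<comment> \<open>Evaluation at the all-ones vector gives the coefficient sum, so the PPS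
    condition passes to any other way of writing the row.\<close>
  have eval_1: "sys_eval P 1 $ i \<le> 1" for i
  proof -
    have "(\<Sum>m\<in>Poly_Mapping.keys (P i). Poly_Mapping.lookup (P i) m) \<le> 1"
      using assms(1) by (simp add: is_PPS_def)
    then have "real_of_rat (\<Sum>m\<in>Poly_Mapping.keys (P i). Poly_Mapping.lookup (P i) m) \<le> 1"
      by simp
    then show ?thesis by (simp add: sys_eval_def poly_eval_def of_rat_sum)
  qed
  interpret quadratic_linear_lfp quad l r "\<lambda>i j. of_rat (p i j)" "\<lambda>i. of_rat (p0 i)" "sys_eval P" q
  proof
    fix i x assume "i \<in> quad"
    then show "sys_eval P x $ i = x $ l i * x $ r i"
      using lr by (simp add: sys_eval_def poly_eval_var_mult_var)
  next
    fix i assume i: "i \<notin> quad"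
    show "sys_eval P x $ i = (\<Sum>j\<in>UNIV. of_rat (p i j) * x $ j) + of_rat (p0 i)" for x
      using lin[OF i] by (simp add: sys_eval_def poly_eval_linear)
    from this[of 1] show "(\<Sum>j\<in>UNIV. real_of_rat (p i j)) + of_rat (p0 i) \<le> 1"
      using eval_1[of i] by simp
    show "0 \<le> real_of_rat (p i j)" for j using nonneg lookup[OF i] by simp
    show "0 \<le> real_of_rat (p0 i)" using nonneg lookup[OF i] by simp
  qed (use assms(3,4) in \<open>auto simp: is_LFP_def\<close>)
  have newton: "newton_iter P k = (newton ^^ k) 0" for k
    by (induction k) (simp_all add: newton_op_def newton_def sys_jacobian_def)
  define N where "N = sys_size P"
  have u: "1 / 2 ^ (4 * N) \<le> u $ k" for k
  proof -
    let ?den = "\<lambda>i. real_of_int (poly_denom (P i))"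
    have den_le: "?den i \<le> 2 ^ poly_size (P i)" for i
      using poly_denom_le[of "P i"] by (metis of_int_le_iff of_int_numeral of_int_power)
    have "1 / (2 ^ (2 * N))\<^sup>2 \<le> u $ k"
    proof (rule u_lower_bound[of ?den])
      fix i assume i: "i \<notin> quad"
      show "1 \<le> ?den i" using poly_denom_ge_1[of "P i"] by linarith
      show "?den i \<in> \<int>" by simp
      show "?den i * real_of_rat (p i j) \<in> \<int>" for j
        using poly_denom_mult_lookup_int lookup[OF i] by metis
      show "?den i * real_of_rat (p0 i) \<in> \<int>"
        using poly_denom_mult_lookup_int lookup[OF i] by metis
      have "poly_size (P i) \<le> (\<Sum>i\<in>UNIV. poly_size (P i))" by (rule member_le_sum) auto
      then have "poly_size (P i) \<le> 2 * N" by (simp add: N_def sys_size_eq)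
      then have "(2 :: real) ^ poly_size (P i) \<le> 2 ^ (2 * N)" by (intro power_increasing) auto
      with den_le[of i] show "?den i \<le> 2 ^ (2 * N)" by (rule order_trans)
    next
      \<comment> \<open>Row \<open>i\<close> contributes at most
        \<open>2 ^ (2 + poly_size (P i))\<close>: a product row has weight \<open>2 ^ 3\<close> and
        positive size, a linear row \<open>2 ^ 2\<close> times its denominator. The exponents sum to
        twice the number of variables plus all row sizes, which is at most
        \<open>2 * N\<close>.\<close>
      have "(\<Prod>i\<in>UNIV. 2 * (if i \<in> quad then 4 else 2 * ?den i)) \<le> (\<Prod>i\<in>UNIV. 2 ^ (2 + poly_size (P i)))"
      proof (intro prod_mono conjI)
        fix i
        have pos: "1 \<le> ?den i" using poly_denom_ge_1[of "P i"] by linarith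
        then show "0 \<le> 2 * (if i \<in> quad then 4 else 2 * ?den i)" by simp
        show "2 * (if i \<in> quad then 4 else 2 * ?den i) \<le> 2 ^ (2 + poly_size (P i))"
        proof (cases "i \<in> quad")
          case True
          then have "P i \<noteq> 0" using lr[OF True] var_mult_var_nonzero by metis
          then have "(2 :: real) ^ 3 \<le> 2 ^ (2 + poly_size (P i))"
            using poly_size_pos by (intro power_increasing) force+
          then show ?thesis using True by simp
        next
          case False
          then show ?thesis using den_le[of i] by (simp add: power_add)
        qed
      qed
      also have "\<dots> = 2 ^ (\<Sum>i\<in>UNIV. 2 + poly_size (P i))" by (rule power_sum[symmetric])
      also have "\<dots> \<le> 2 ^ (2 * N)"
      proof (rule power_increasing)
        have "(\<Sum>i\<in>UNIV. 2 + poly_size (P i)) = 2 * CARD('n) + (\<Sum>i\<in>UNIV. poly_size (P i))"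
          by (simp only: sum.distrib) simp
        then show "(\<Sum>i\<in>UNIV. 2 + poly_size (P i)) \<le> 2 * N"
          by (simp add: N_def sys_size_eq)
      qed simp
      finally show "(\<Prod>i\<in>UNIV. 2 * (if i \<in> quad then 4 else 2 * ?den i)) \<le> 2 ^ (2 * N)" .
    qed simp
    then show ?thesis by (simp add: mult.commute flip: power_mult)
  qed
  \<comment> \<open>All \<open>2 * i\<close> extra iterations are squarings, which yields the
    exponent \<open>2 ^ (2 * i)\<close>, stronger than the claimed \<open>2 ^ i\<close>.\<close>
  have "infnorm (q - newton_iter P (32 * N + 2 + 2 * i)) \<le> 1 / 2 ^ ((28 * N + 2) * 2 ^ (2 * i))"
    unfolding newton by (rule newton_iterate_error[OF u])
  also have "\<dots> \<le> 1 / 2 ^ ((28 * N + 2) * 2 ^ i)"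
    by (intro divide_left_mono power_increasing mult_left_mono) auto
  finally have "infnorm (q - newton_iter P (32 * N + 2 + 2 * i)) \<le> 1 / 2 ^ ((28 * N + 2) * 2 ^ i)" .
  moreover have "(1 :: real) / 2 ^ ((28 * N + 2) * 2 ^ i) \<le> 1 / 2 ^ (2 ^ i)"
    by (intro divide_left_mono power_increasing) auto
  moreover have "invertible (mat 1 - sys_jacobian P (newton_iter P k))" for k
    unfolding sys_jacobian_def newton
    using newton_iterate_invariant[of k] by (intro invertible_newton_matrix) auto
  ultimately show ?thesis by (simp add: N_def)
qed

end
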